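(* Let $A$ be a $C^*$-algebra. Then $\operatorname{rr}(A)\le\operatorname{gr}(A)$.
   Context: Notation: for a $C^*$-algebra $A$, $A_{\mathrm{sa}}$ is the set of self-adjoint elements and $A^{n}_{\mathrm{sa}}=(A_{\mathrm{sa}})^{n}$; $C^*(b_0,\dots,b_n)$ is the (not necessarily unital) sub-$C^*$-algebra generated by $b_0,\dots,b_n$; $\widetilde{A}$ is the minimal unitization ($\widetilde A=A$ if $A$ is unital). For $G\subseteq A$, $c\in_\varepsilon G$ means that there is $g\in G$ with $\|c-g\|<\varepsilon$. $\operatorname{gr}_0(A)$ is the smallest integer $n\ge 0$ such that for all $a_0,\dots,a_n\in A_{\mathrm{sa}}$, $\varepsilon>0$ and $c\in A$ there exist $b_0,\dots,b_n\in A_{\mathrm{sa}}$ with $\|b_j-a_j\|<\varepsilon$ for $j=0,\dots,n$ and $c\in_\varepsilon C^*(b_0,\dots,b_n)$; $\operatorname{gr}_0(A)=\infty$ if no such $n$ exists. The generator rank of $A$ is $\operatorname{gr}(A):=\operatorname{gr}_0(\widetilde A)$. Real rank: for unital $A$, $\operatorname{rr}(A)$ is the smallest integer $n\ge0$ such that the set of tuples $(a_0,\dots,a_n)\in A^{n+1}_{\mathrm{sa}}$ with $\sum_{j=0}^n a_j^*a_j$ invertible is dense in $A^{n+1}_{\mathrm{sa}}$ ($\infty$ if there is none); for nonunital $A$, $\operatorname{rr}(A):=\operatorname{rr}(\widetilde A)$. *)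

theory Defs
  imports "HOL-Analysis.Analysis" "HOL-Library.Extended_Nat"
begin

section \<open>C*-algebras\<close>

text \<open>Complex C*-algebras, not necessarily unital and possibly zero. The norm and completeness come
  from the library classes; the real scalar multiplication of those classes is required to be the
  restriction of the complex one.\<close>

class cstar_algebra = real_normed_algebra + banach +
  fixes scaleC :: "complex \<Rightarrow> 'a \<Rightarrow> 'a" (infixr "*\<^sub>C" 75)
    and star :: "'a \<Rightarrow> 'a"
  assumes scaleC_add_right: "c *\<^sub>C (x + y) = c *\<^sub>C x + c *\<^sub>C y"
    and scaleC_add_left: "(c + d) *\<^sub>C x = c *\<^sub>C x + d *\<^sub>C x"
    and scaleC_scaleC: "c *\<^sub>C d *\<^sub>C x = (c * d) *\<^sub>C x"
    and scaleC_of_real: "complex_of_real r *\<^sub>C x = r *\<^sub>R x"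
    and norm_scaleC: "norm (c *\<^sub>C x) = cmod c * norm x"
    and mult_scaleC_left: "(c *\<^sub>C x) * y = c *\<^sub>C (x * y)"
    and mult_scaleC_right: "x * (c *\<^sub>C y) = c *\<^sub>C (x * y)"
    and star_star: "star (star x) = x"
    and star_add: "star (x + y) = star x + star y"
    and star_scaleC: "star (c *\<^sub>C x) = cnj c *\<^sub>C star x"
    and star_mult: "star (x * y) = star y * star x"
    and cstar_identity: "norm (star x * x) = (norm x)\<^sup>2"

instantiation complex :: cstar_algebra
begin

definition "scaleC_complex = ((*) :: complex \<Rightarrow> complex \<Rightarrow> complex)"
definition "star_complex = cnj"

instance
  by standard (auto simp: scaleC_complex_def star_complex_def algebra_simps norm_mult
      power2_eq_square scaleR_conv_of_real)

end

definition self_adjoint :: "'a::cstar_algebra set" where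
  "self_adjoint = {a. star a = a}"

definition is_identity :: "'a::cstar_algebra \<Rightarrow> bool" where
  "is_identity e \<longleftrightarrow> (\<forall>x. e * x = x \<and> x * e = x)"

definition unital :: "'a::cstar_algebra itself \<Rightarrow> bool" where
  "unital _ \<longleftrightarrow> (\<exists>e::'a. is_identity e)"

definition cstar_invertible :: "'a::cstar_algebra \<Rightarrow> bool" where
  "cstar_invertible x \<longleftrightarrow> (\<exists>e y. is_identity e \<and> x * y = e \<and> y * x = e)"

definition cstar_subalgebra :: "'a::cstar_algebra set \<Rightarrow> bool" where
  "cstar_subalgebra S \<longleftrightarrow> closed S \<and> 0 \<in> S
     \<and> (\<forall>x\<in>S. \<forall>y\<in>S. x + y \<in> S \<and> x * y \<in> S)
     \<and> (\<forall>x\<in>S. star x \<in> S \<and> (\<forall>c. c *\<^sub>C x \<in> S))"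

definition cstar_generated :: "'a::cstar_algebra set \<Rightarrow> 'a set" where
  "cstar_generated G = cstar_subalgebra hull G"


section \<open>Elementary consequences of the axioms\<close>

lemma scaleC_one [simp]: "1 *\<^sub>C x = x"
  for x :: "'a::cstar_algebra"
  using scaleC_of_real[of 1 x] by simp

lemma scaleC_zero_left [simp]: "0 *\<^sub>C x = 0"
  for x :: "'a::cstar_algebra"
  using scaleC_of_real[of 0 x] by simp

lemma scaleC_zero_right [simp]: "c *\<^sub>C (0::'a::cstar_algebra) = 0"
  using scaleC_add_right[of c "0::'a" 0] by simp

lemma scaleC_minus_right: "c *\<^sub>C (- x) = - (c *\<^sub>C x)"
  for x :: "'a::cstar_algebra"
  using scaleC_add_right[of c x "- x"] by (simp add: eq_neg_iff_add_eq_0 add.commute)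

lemma scaleC_minus_left: "(- c) *\<^sub>C x = - (c *\<^sub>C x)"
  for x :: "'a::cstar_algebra"
  using scaleC_add_left[of c "- c" x] by (simp add: eq_neg_iff_add_eq_0 add.commute)

lemma scaleR_scaleC: "r *\<^sub>R c *\<^sub>C x = (of_real r * c) *\<^sub>C x"
  for x :: "'a::cstar_algebra"
  by (metis scaleC_of_real scaleC_scaleC)

lemma scaleC_scaleR: "c *\<^sub>C r *\<^sub>R x = (of_real r * c) *\<^sub>C x"
  for x :: "'a::cstar_algebra"
  by (metis scaleC_of_real scaleC_scaleC mult.commute)

lemma norm_star [simp]: "norm (star x) = norm x"
  for x :: "'a::cstar_algebra"
proof -
  have le: "norm y \<le> norm (star y)" for y :: 'a
  proof (cases "norm y = 0")
    case False
    have "norm y * norm y \<le> norm (star y) * norm y"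
      using cstar_identity[of y] norm_mult_ineq[of "star y" y] by (simp add: power2_eq_square)
    with False show ?thesis by simp
  qed simp
  from le[of x] le[of "star x"] show ?thesis by (simp add: star_star)
qed


section \<open>Unitization\<close>

datatype 'a unitization = Unitization (ua: 'a) (uc: complex)

text \<open>Left multiplication on the algebra by the element written formally as \<open>a + \<lambda>1\<close>.\<close>

definition unitization_act :: "'a::cstar_algebra unitization \<Rightarrow> 'a \<Rightarrow> 'a" where
  "unitization_act u = (\<lambda>y. ua u * y + uc u *\<^sub>C y)"

instantiation unitization :: (cstar_algebra) real_vector
begin

definition "0 = Unitization 0 0"
definition "u + v = Unitization (ua u + ua v) (uc u + uc v)"
definition "- u = Unitization (- ua u) (- uc u)"
definition "u - v = Unitization (ua u - ua v) (uc u - uc v)"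
definition "r *\<^sub>R u = Unitization (r *\<^sub>R ua u) (r *\<^sub>R uc u)"

lemmas unitization_vector_ops = zero_unitization_def plus_unitization_def uminus_unitization_def
  minus_unitization_def scaleR_unitization_def

instance
proof
  fix u v w :: "'a unitization" and r s :: real
  show "u + v + w = u + (v + w)" "u + v = v + u" "0 + u = u" "- u + u = 0" "u - v = u + - v"
    unfolding unitization_vector_ops by (simp_all add: algebra_simps)
  show "r *\<^sub>R (u + v) = r *\<^sub>R u + r *\<^sub>R v" "(r + s) *\<^sub>R u = r *\<^sub>R u + s *\<^sub>R u"
    "r *\<^sub>R s *\<^sub>R u = (r * s) *\<^sub>R u" "1 *\<^sub>R u = u"
    unfolding unitization_vector_ops by (simp_all add: algebra_simps)
qed

end

instantiation unitization :: (cstar_algebra) real_algebra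
begin

definition "u * v = Unitization (ua u * ua v + uc v *\<^sub>C ua u + uc u *\<^sub>C ua v) (uc u * uc v)"

lemmas unitization_ops = unitization_vector_ops times_unitization_def

instance
proof
  fix u v w :: "'a unitization" and r :: real
  show "u * v * w = u * (v * w)" "(u + v) * w = u * w + v * w" "u * (v + w) = u * v + u * w"
    unfolding unitization_ops by (simp_all add: algebra_simps scaleC_add_left scaleC_add_right scaleC_scaleC
        mult_scaleC_left mult_scaleC_right)
  show "r *\<^sub>R u * v = r *\<^sub>R (u * v)" "u * r *\<^sub>R v = r *\<^sub>R (u * v)"
    unfolding unitization_ops by (simp_all add: algebra_simps scaleR_scaleC scaleC_scaleR scaleR_conv_of_real)
qed

end

lemma bounded_linear_unitization_act: "bounded_linear (unitization_act u)"
  for u :: "'a::cstar_algebra unitization"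
proof -
  have "bounded_linear (\<lambda>y::'a. uc u *\<^sub>C y)"
    by (rule bounded_linear_intro[where K = "cmod (uc u)"])
      (simp_all add: scaleC_add_right scaleC_scaleR scaleR_scaleC norm_scaleC mult.commute)
  then show ?thesis
    unfolding unitization_act_def by (intro bounded_linear_add bounded_linear_mult_right)
qed

lemma norm_unitization_act: "norm (unitization_act u y) \<le> onorm (unitization_act u) * norm y"
  for u :: "'a::cstar_algebra unitization"
  by (rule onorm[OF bounded_linear_unitization_act])

lemma unitization_act_add:
  "unitization_act (u + v) = (\<lambda>y. unitization_act u y + unitization_act v y)"
  unfolding unitization_act_def unitization_ops by (auto simp: algebra_simps scaleC_add_left)

lemma unitization_act_mult:
  "unitization_act (u * v) = unitization_act u \<circ> unitization_act v"
  unfolding unitization_act_def unitization_ops by (auto simp: fun_eq_iff algebra_simps scaleC_add_left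
      scaleC_add_right scaleC_scaleC mult_scaleC_left mult_scaleC_right)

lemma norm_ua_le: "norm (ua u) \<le> onorm (unitization_act u) + cmod (uc u)"
  for u :: "'a::cstar_algebra unitization"
proof (cases "ua u = 0")
  case False
  let ?a = "ua u"
  have "norm ?a * norm ?a = norm (?a * star ?a)"
    using cstar_identity[of "star ?a"] by (simp add: star_star power2_eq_square)
  also have "?a * star ?a = unitization_act u (star ?a) - uc u *\<^sub>C star ?a"
    by (simp add: unitization_act_def)
  also have "norm \<dots> \<le> norm (unitization_act u (star ?a)) + norm (uc u *\<^sub>C star ?a)"
    by (rule norm_triangle_ineq4)
  also have "\<dots> \<le> (onorm (unitization_act u) + cmod (uc u)) * norm ?a"
    using norm_unitization_act[of u "star ?a"] by (simp add: norm_scaleC algebra_simps)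
  finally show ?thesis using False by simp
qed (simp add: onorm_pos_le bounded_linear_unitization_act)

lemma onorm_act_le: "onorm (unitization_act u) \<le> norm (ua u) + cmod (uc u)"
  for u :: "'a::cstar_algebra unitization"
proof (rule onorm_bound)
  fix y
  show "norm (unitization_act u y) \<le> (norm (ua u) + cmod (uc u)) * norm y"
    unfolding unitization_act_def using norm_triangle_ineq[of "ua u * y" "uc u *\<^sub>C y"]
      norm_mult_ineq[of "ua u" y] by (simp add: norm_scaleC algebra_simps)
qed simp

text \<open>On a nonunital algebra the norm below is the operator norm of left multiplication
  (lemma \<open>norm_unitization_nonunital\<close>). The maximum with \<open>\<bar>\<lambda>\<bar>\<close> only matters if the
  algebra is unital, where it makes the type the direct sum of the algebra with the complex
  numbers, so that the type is a C*-algebra in all cases.\<close>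

instantiation unitization :: (cstar_algebra) real_normed_algebra
begin

definition "norm u = max (cmod (uc u)) (onorm (unitization_act u))"
definition "dist u v = norm (u - v)" for u v :: "'a unitization"
definition "sgn u = inverse (norm u) *\<^sub>R u" for u :: "'a unitization"
definition [code del]:
  "(uniformity :: ('a unitization \<times> 'a unitization) filter) =
     (INF e\<in>{0 <..}. principal {(x, y). dist x y < e})"
definition [code del]:
  "open (U :: 'a unitization set) \<longleftrightarrow>
     (\<forall>x\<in>U. eventually (\<lambda>(x', y). x' = x \<longrightarrow> y \<in> U) uniformity)"

instance
proof
  fix u v :: "'a unitization" and r :: real
  have pos: "0 \<le> onorm (unitization_act x)" for x :: "'a unitization"
    by (rule onorm_pos_le[OF bounded_linear_unitization_act])
  have "unitization_act (r *\<^sub>R u) = (\<lambda>y. r *\<^sub>R unitization_act u y)"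
    unfolding unitization_act_def unitization_ops by (auto simp: scaleR_scaleC scaleR_conv_of_real algebra_simps)
  then show "norm (r *\<^sub>R u) = \<bar>r\<bar> * norm u"
    using onorm_scaleR[OF bounded_linear_unitization_act[of u], of r]
    unfolding norm_unitization_def by (simp add: max_mult_distrib_left scaleR_unitization_def)
  show "norm (u + v) \<le> norm u + norm v"
  proof -
    have "onorm (unitization_act (u + v)) \<le> onorm (unitization_act u) + onorm (unitization_act v)"
      unfolding unitization_act_add
      by (rule onorm_triangle; rule bounded_linear_unitization_act)
    moreover have "cmod (uc (u + v)) \<le> cmod (uc u) + cmod (uc v)"
      unfolding unitization_ops by (simp add: norm_triangle_ineq)
    ultimately show ?thesis unfolding norm_unitization_def by (auto simp: max_def)
  qed
  show "norm (u * v) \<le> norm u * norm v"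
  proof -
    have "onorm (unitization_act (u * v)) \<le> onorm (unitization_act u) * onorm (unitization_act v)"
      unfolding unitization_act_mult
      by (rule onorm_compose; rule bounded_linear_unitization_act)
    also have "\<dots> \<le> norm u * norm v"
      unfolding norm_unitization_def by (intro mult_mono) (auto simp: pos le_max_iff_disj)
    finally have 1: "onorm (unitization_act (u * v)) \<le> norm u * norm v" .
    have "cmod (uc (u * v)) = cmod (uc u) * cmod (uc v)"
      unfolding unitization_ops by (simp add: norm_mult)
    also have "\<dots> \<le> norm u * norm v"
      unfolding norm_unitization_def by (intro mult_mono) (auto simp: pos le_max_iff_disj)
    finally show ?thesis using 1 by (simp add: norm_unitization_def[of "u * v"])
  qed
  show "norm u = 0 \<longleftrightarrow> u = 0"
  proof
    assume "norm u = 0"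
    then have "cmod (uc u) = 0" "onorm (unitization_act u) = 0"
      using pos[of u] norm_ge_zero[of "uc u"] unfolding norm_unitization_def
      by (auto simp: max_def split: if_splits)
    with norm_ua_le[of u] show "u = 0"
      by (cases u) (simp add: unitization_ops)
  next
    assume "u = 0"
    with onorm_act_le[of u] pos[of u] show "norm u = 0"
      unfolding norm_unitization_def by (simp add: zero_unitization_def)
  qed
  show "dist u v = norm (u - v)"
    by (rule dist_unitization_def)
  show "sgn u = u /\<^sub>R norm u"
    by (rule sgn_unitization_def)
  show "(uniformity :: ('a unitization \<times> 'a unitization) filter) =
     (INF e\<in>{0 <..}. principal {(x, y). dist x y < e})"
    by (rule uniformity_unitization_def)
  show "open U \<longleftrightarrow> (\<forall>x\<in>U. eventually (\<lambda>(x', y). x' = x \<longrightarrow> y \<in> U) uniformity)"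
    for U :: "'a unitization set"
    by (rule open_unitization_def)
qed

end

instance unitization :: (cstar_algebra) banach
proof
  show "convergent X" if X: "Cauchy X" for X :: "nat \<Rightarrow> 'a unitization"
  proof -
    have uc: "cmod (uc x - uc y) \<le> dist x y" for x y :: "'a unitization"
      by (simp add: dist_unitization_def norm_unitization_def minus_unitization_def)
    have ua: "norm (ua x - ua y) \<le> 2 * dist x y" for x y :: "'a unitization"
      using norm_ua_le[of "x - y"]
      by (simp add: dist_unitization_def norm_unitization_def minus_unitization_def)
    have "Cauchy (\<lambda>n. uc (X n))"
      using X uc unfolding Cauchy_def dist_norm[of "uc _"] by (meson le_less_trans)
    moreover have "Cauchy (\<lambda>n. ua (X n))"
      unfolding Cauchy_def
    proof (intro allI impI)
      fix e :: real assume "0 < e"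
      with X obtain M where M: "\<forall>m\<ge>M. \<forall>n\<ge>M. dist (X m) (X n) < e / 2"
        unfolding Cauchy_def by (meson half_gt_zero)
      have "dist (ua (X m)) (ua (X n)) < e" if "M \<le> m" "M \<le> n" for m n
      proof -
        have "dist (X m) (X n) < e / 2" using M that by blast
        with ua[of "X m" "X n"] show ?thesis by (simp add: dist_norm[of "ua _"])
      qed
      then show "\<exists>M. \<forall>m\<ge>M. \<forall>n\<ge>M. dist (ua (X m)) (ua (X n)) < e"
        by blast
    qed
    ultimately obtain a l where al: "(\<lambda>n. ua (X n)) \<longlonglongrightarrow> a" "(\<lambda>n. uc (X n)) \<longlonglongrightarrow> l"
      by (meson Cauchy_convergent convergentD)
    have lim: "(\<lambda>n. norm (ua (X n) - a) + cmod (uc (X n) - l)) \<longlonglongrightarrow> 0"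
      using tendsto_add[OF al(1)[THEN LIM_zero, THEN tendsto_norm_zero]
          al(2)[THEN LIM_zero, THEN tendsto_norm_zero]] by simp
    have le: "dist (X n) (Unitization a l) \<le> norm (ua (X n) - a) + cmod (uc (X n) - l)" for n
      using onorm_act_le[of "X n - Unitization a l"]
      by (simp add: dist_unitization_def norm_unitization_def minus_unitization_def)
    have "(\<lambda>n. dist (X n) (Unitization a l)) \<longlonglongrightarrow> 0"
      by (rule Lim_null_comparison[OF _ lim]) (simp add: le)
    then show ?thesis
      using tendsto_dist_iff[of X "Unitization a l" sequentially] by (auto simp: convergent_def)
  qed
qed

instantiation unitization :: (cstar_algebra) cstar_algebra
begin

definition "c *\<^sub>C u = Unitization (c *\<^sub>C ua u) (c * uc u)"
definition "star u = Unitization (star (ua u)) (cnj (uc u))"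

lemmas unitization_cstar_ops = unitization_ops scaleC_unitization_def star_unitization_def

lemma unitization_act_scaleC:
  "unitization_act (c *\<^sub>C u) = (\<lambda>y. c *\<^sub>C unitization_act u y)"
  unfolding unitization_act_def unitization_cstar_ops by (auto simp: scaleC_add_right scaleC_scaleC mult_scaleC_left)

lemma star_unitization_act:
  "star (unitization_act u y) * unitization_act u y = star y * unitization_act (star u * u) y"
  by (simp add: unitization_act_mult)
    (simp add: unitization_act_def unitization_cstar_ops algebra_simps star_add star_mult star_scaleC
      scaleC_add_right scaleC_scaleC mult_scaleC_left mult_scaleC_right mult.commute[of "cnj _"])

lemma onorm_act_star_mult:
  "onorm (unitization_act (star u * u)) = (onorm (unitization_act u))\<^sup>2"
  for u :: "'a unitization"
proof -
  let ?N = "\<lambda>v::'a unitization. onorm (unitization_act v)"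
  have pos: "0 \<le> ?N v" for v
    by (rule onorm_pos_le[OF bounded_linear_unitization_act])
  have sub: "?N (v * w) \<le> ?N v * ?N w" for v w
    unfolding unitization_act_mult
    by (rule onorm_compose; rule bounded_linear_unitization_act)
  have sq: "(?N v)\<^sup>2 \<le> ?N (star v * v)" for v
  proof -
    have "?N v \<le> sqrt (?N (star v * v))"
    proof (rule onorm_bound)
      fix y
      have "(norm (unitization_act v y))\<^sup>2 = norm (star y * unitization_act (star v * v) y)"
        by (simp add: cstar_identity[symmetric] star_unitization_act)
      also have "\<dots> \<le> norm y * norm (unitization_act (star v * v) y)"
        using norm_mult_ineq[of "star y"] by simp
      also have "\<dots> \<le> norm y * (?N (star v * v) * norm y)"
        by (intro mult_left_mono norm_unitization_act) simp
      also have "\<dots> = (sqrt (?N (star v * v)) * norm y)\<^sup>2"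
        using pos by (simp add: power_mult_distrib) (simp add: power2_eq_square)
      finally show "norm (unitization_act v y) \<le> sqrt (?N (star v * v)) * norm y"
        by (rule power2_le_imp_le) (simp add: pos)
    qed (simp add: pos)
    from power_mono[OF this pos, of 2] show ?thesis by (simp add: pos)
  qed
  have le: "?N v \<le> ?N (star v)" for v
  proof (cases "?N v = 0")
    case False
    have "?N v * ?N v \<le> ?N (star v) * ?N v"
      using sq[of v] sub[of "star v" v] by (simp add: power2_eq_square)
    with False pos[of v] show ?thesis by simp
  qed (simp add: pos)
  have "star (star u) = u"
    unfolding unitization_cstar_ops by (simp add: star_star)
  with le[of u] le[of "star u"] have "?N (star u) = ?N u" by simp
  with sub[of "star u" u] sq[of u] show ?thesis by (simp add: power2_eq_square)
qed

instance
proof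
  fix u v :: "'a unitization" and c d :: complex
  have pos: "0 \<le> onorm (unitization_act x)" for x :: "'a unitization"
    by (rule onorm_pos_le[OF bounded_linear_unitization_act])
  show "c *\<^sub>C (u + v) = c *\<^sub>C u + c *\<^sub>C v" "(c + d) *\<^sub>C u = c *\<^sub>C u + d *\<^sub>C u"
    "c *\<^sub>C d *\<^sub>C u = (c * d) *\<^sub>C u"
    unfolding unitization_cstar_ops by (simp_all add: algebra_simps scaleC_add_left scaleC_add_right scaleC_scaleC)
  show "complex_of_real r *\<^sub>C u = r *\<^sub>R u" for r and u :: "'a unitization"
    unfolding unitization_cstar_ops by (simp add: scaleC_of_real scaleR_conv_of_real)
  show "c *\<^sub>C u * v = c *\<^sub>C (u * v)" "u * c *\<^sub>C v = c *\<^sub>C (u * v)"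
    unfolding unitization_cstar_ops by (simp_all add: scaleC_add_right scaleC_scaleC mult_scaleC_left
        mult_scaleC_right ac_simps)
  show "star (star u) = u" "star (u + v) = star u + star v" "star (c *\<^sub>C u) = cnj c *\<^sub>C star u"
    "star (u * v) = star v * star u"
    unfolding unitization_cstar_ops by (simp_all add: star_star star_add star_scaleC star_mult algebra_simps)
  show "norm (star u * u) = (norm u)\<^sup>2"
  proof -
    have "cmod (uc (star u * u)) = (cmod (uc u))\<^sup>2"
      unfolding unitization_cstar_ops by (simp add: norm_mult power2_eq_square)
    then show ?thesis
      using pos[of u] by (simp add: norm_unitization_def onorm_act_star_mult max_def)
  qed
  show "norm (c *\<^sub>C u) = cmod c * norm u" for c and u :: "'a unitization"
  proof -
    have le: "onorm (unitization_act (c *\<^sub>C u)) \<le> cmod c * onorm (unitization_act u)"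
      for c and u :: "'a unitization"
      by (rule onorm_bound)
        (auto simp: pos unitization_act_scaleC norm_scaleC mult.assoc
          intro!: mult_left_mono norm_unitization_act)
    have "onorm (unitization_act (c *\<^sub>C u)) = cmod c * onorm (unitization_act u)"
    proof (cases "c = 0")
      case True
      with le[of c u] pos[of "c *\<^sub>C u"] show ?thesis by simp
    next
      case False
      have "u = inverse c *\<^sub>C c *\<^sub>C u"
        using False by (cases u) (simp add: unitization_cstar_ops scaleC_scaleC mult.assoc[symmetric])
      with le[of "inverse c" "c *\<^sub>C u"]
      have "onorm (unitization_act u) \<le> inverse (cmod c) * onorm (unitization_act (c *\<^sub>C u))"
        by (simp add: norm_inverse)
      with le[of c u] False show ?thesis by (simp add: field_simps)
    qed
    moreover have "cmod (uc (c *\<^sub>C u)) = cmod c * cmod (uc u)"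
      unfolding unitization_cstar_ops by (simp add: norm_mult)
    ultimately show ?thesis
      by (simp add: norm_unitization_def max_mult_distrib_left)
  qed
qed

end

lemma is_identity_unitization: "is_identity (Unitization 0 1)"
  by (simp add: is_identity_def unitization_ops)

lemma norm_unitization_nonunital:
  fixes u :: "'a::cstar_algebra unitization"
  assumes "\<not> unital TYPE('a)"
  shows "norm u = onorm (unitization_act u)"
proof -
  have "cmod (uc u) \<le> onorm (unitization_act u)"
  proof (rule ccontr)
    assume *: "\<not> cmod (uc u) \<le> onorm (unitization_act u)"
    let ?N = "onorm (unitization_act u)"
    define l where "l = uc u"
    define q where "q = ?N / cmod l"
    have N: "0 \<le> ?N"
      by (rule onorm_pos_le[OF bounded_linear_unitization_act])
    have l: "l \<noteq> 0" and q: "0 \<le> q" "q < 1"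
      using * N by (auto simp: l_def q_def divide_less_eq)
    define b where "b = - (inverse l *\<^sub>C ua u)"
    have act: "y - b * y = inverse l *\<^sub>C unitization_act u y" for y
      using l by (simp add: b_def unitization_act_def scaleC_add_right scaleC_scaleC
          mult_scaleC_left l_def[symmetric])
    have b: "norm (y - b * y) \<le> q * norm y" for y
      unfolding act norm_scaleC
      using norm_unitization_act[of u y] l by (simp add: q_def norm_inverse divide_inverse mult_ac)
    have "\<exists>!e. e - b * e + b = e"
    proof (rule banach_fix_type[OF q], intro allI)
      show "dist (x - b * x + b) (y - b * y + b) \<le> q * dist x y" for x y
        using b[of "x - y"] by (simp add: dist_norm algebra_simps)
    qed
    then obtain e where fixp: "e - b * e + b = e" by blast
    have "b - b * e = (e - b * e + b) - e" by simp
    then have e: "b * e = b" unfolding fixp by simp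
    have left: "e * x = x" for x
    proof -
      have "norm (e * x - x) \<le> q * norm (e * x - x)"
        using b[of "e * x - x"] e by (simp add: right_diff_distrib flip: mult.assoc)
      then have "(1 - q) * norm (e * x - x) \<le> 0" by (simp add: algebra_simps)
      with q have "norm (e * x - x) \<le> 0" by (simp add: mult_le_0_iff)
      then show ?thesis by simp
    qed
    have right: "x * star e = x" for x
      using left[of "star x"] by (metis star_mult star_star)
    have "e = star e" using left[of "star e"] right[of e] by simp
    with left right have "is_identity e" by (simp add: is_identity_def)
    with assms show False by (auto simp: unital_def)
  qed
  then show ?thesis by (simp add: norm_unitization_def)
qed


section \<open>Real rank and generator rank\<close>

text \<open>Ranks are extended natural numbers; the infimum of the empty set is \<open>\<infinity>\<close>. Tuples indexed by
  \<open>0,\<dots>,n\<close> are points of the product space over the index set \<open>{..n}\<close>.\<close>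

definition sa_tuples :: "nat \<Rightarrow> (nat \<Rightarrow> 'a::cstar_algebra) topology" where
  "sa_tuples n = product_topology (\<lambda>_. top_of_set self_adjoint) {..n}"

definition unital_rr :: "'a::cstar_algebra itself \<Rightarrow> enat" where
  "unital_rr _ = Inf (enat ` {n.
     sa_tuples n closure_of
       {a \<in> topspace (sa_tuples n). cstar_invertible (\<Sum>j\<le>n. star (a j) * (a j :: 'a))}
     = topspace (sa_tuples n)})"

definition rr :: "'a::cstar_algebra itself \<Rightarrow> enat" where
  "rr T = (if unital T then unital_rr T else unital_rr TYPE('a unitization))"

definition gr0 :: "'a::cstar_algebra itself \<Rightarrow> enat" where
  "gr0 _ = Inf (enat ` {n.
     \<forall>a \<in> {..n} \<rightarrow> self_adjoint. \<forall>\<epsilon>>0. \<forall>c::'a.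
       \<exists>b \<in> {..n} \<rightarrow> self_adjoint.
         (\<forall>j\<le>n. norm (b j - a j) < \<epsilon>) \<and> (\<exists>g \<in> cstar_generated (b ` {..n}). norm (c - g) < \<epsilon>)})"

definition gr :: "'a::cstar_algebra itself \<Rightarrow> enat" where
  "gr T = (if unital T then gr0 T else gr0 TYPE('a unitization))"

end

theory Submission
  imports Defs
begin

text \<open>
  Let \<open>b\<^sub>0, \<dots>, b\<^sub>n\<close> be self-adjoint and let the unit \<open>e\<close> be within distance less than 1 of
  \<open>C*(b\<^sub>0, \<dots>, b\<^sub>n)\<close>. The closed left ideal generated by the \<open>b\<^sub>j\<close> contains \<open>C*(b\<^sub>0, \<dots>, b\<^sub>n)\<close>, so the
  left ideal contains an invertible element and \<open>e = \<Sum>j. x\<^sub>j b\<^sub>j\<close> for suitable \<open>x\<^sub>j\<close>. With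
  \<open>s = \<Sum>j. b\<^sub>j\<^sup>2\<close> and \<open>r = (s + t)\<^sup>-\<^sup>1\<close>, \<open>t > 0\<close>, one has \<open>t b\<^sub>j\<^sup>2 \<le> (s + t)\<^sup>2\<close>, whence
  \<open>\<parallel>b\<^sub>j r\<parallel> \<le> t\<^sup>-\<^sup>1\<^sup>/\<^sup>2\<close> and \<open>\<parallel>t r\<parallel> \<le> t\<^sup>1\<^sup>/\<^sup>2 \<Sum>j. \<parallel>x\<^sub>j\<parallel>\<close>, which is less than 1 for small \<open>t\<close>. Then
  \<open>s r = e - t r\<close> is invertible, and so is \<open>s\<close>. Hence every \<open>n\<close> admissible for the generator rank
  is admissible for the real rank. The little order theory needed is obtained without functional
  calculus: square roots near \<open>e\<close> are fixed points of a contraction, and norms are bounded by means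
  of unitaries \<open>y + i d\<close>.
\<close>

section \<open>The involution\<close>

lemma star_scaleR: "star (r *\<^sub>R x) = r *\<^sub>R star x" for x :: "'a::cstar_algebra"
  using star_scaleC[of "complex_of_real r" x] by (simp add: scaleC_of_real)

lemma bounded_linear_star: "bounded_linear (star :: 'a::cstar_algebra \<Rightarrow> 'a)"
  by (rule bounded_linear_intro[where K = 1]) (simp_all add: star_add star_scaleR)

lemmas star_zero = linear_0[OF bounded_linear.linear[OF bounded_linear_star]]
lemmas star_diff = linear_diff[OF bounded_linear.linear[OF bounded_linear_star]]
lemmas star_sum = linear_sum[OF bounded_linear.linear[OF bounded_linear_star]]
lemmas continuous_on_star [continuous_intros] = bounded_linear.continuous_on[OF bounded_linear_star]

lemma bounded_linear_scaleC: "bounded_linear (\<lambda>x::'a::cstar_algebra. c *\<^sub>C x)"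
  by (rule bounded_linear_intro[where K = "cmod c"])
    (simp_all add: scaleC_add_right scaleC_scaleR scaleR_scaleC norm_scaleC mult.commute)

lemma norm_square_self_adjoint:
  fixes x :: "'a::cstar_algebra"
  assumes "star x = x"
  shows "norm (x * x) = (norm x)\<^sup>2"
  using cstar_identity[of x] assms by simp


section \<open>Invertible and positive elements\<close>

locale unital_cstar_algebra =
  fixes e :: "'a::cstar_algebra"
  assumes is_identity: "is_identity e"
begin

lemma e_mult [simp]: "e * x = x" and mult_e [simp]: "x * e = x"
  using is_identity by (auto simp: is_identity_def)

lemma star_e [simp]: "star e = e"
  by (metis e_mult mult_e star_mult star_star)

text \<open>The C*-identity makes the norm idempotent, hence 0 or 1. The value 0 occurs for the zero
  algebra, which counts as unital.\<close>

lemma norm_e: "norm e \<le> 1"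
  using norm_square_self_adjoint[of e] by (auto simp: power2_eq_square)

section \<open>Invertible elements\<close>

lemma cstar_invertible_iff: "cstar_invertible x \<longleftrightarrow> (\<exists>y. x * y = e \<and> y * x = e)"
  unfolding cstar_invertible_def using is_identity by (metis is_identity_def)

lemma cstar_invertibleI: "x * y = e \<Longrightarrow> y * x = e \<Longrightarrow> cstar_invertible x"
  by (auto simp: cstar_invertible_iff)

lemma cstar_invertible_mult:
  fixes x y :: 'a
  assumes "cstar_invertible x" "cstar_invertible y"
  shows "cstar_invertible (x * y)"
proof -
  obtain x' y' where "x * x' = e" "x' * x = e" "y * y' = e" "y' * y = e"
    using assms by (auto simp: cstar_invertible_iff)
  then have "x * y * (y' * x') = e" "y' * x' * (x * y) = e"
    by (metis mult.assoc mult_e)+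
  then show ?thesis by (rule cstar_invertibleI)
qed

lemma cstar_invertible_scaleR:
  fixes x :: 'a
  assumes "cstar_invertible x" "r \<noteq> 0"
  shows "cstar_invertible (r *\<^sub>R x)"
proof -
  obtain y where "x * y = e" "y * x = e"
    using assms by (auto simp: cstar_invertible_iff)
  with assms(2) show ?thesis
    by (intro cstar_invertibleI[where y = "inverse r *\<^sub>R y"]) simp_all
qed

text \<open>Instead of summing a Neumann series, one-sided inverses are found as fixed points of
  maps with Lipschitz constant \<open>norm (e - x)\<close>; a left and a right inverse
  coincide.\<close>

lemma cstar_invertible_near_e:
  assumes "norm (e - x) < 1"
  shows "cstar_invertible x"
proof -
  have "\<exists>!y. y - x * y + e = y"
  proof (rule banach_fix_type[OF norm_ge_zero assms], intro allI)
    show "dist (y - x * y + e) (z - x * z + e) \<le> norm (e - x) * dist y z" for y z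
      using norm_mult_ineq[of "e - x" "y - z"] by (simp add: dist_norm algebra_simps)
  qed
  then obtain y where y: "x * y = e"
    by (metis add.commute add_diff_cancel_left' diff_add_cancel diff_add_eq)
  have "\<exists>!y. y - y * x + e = y"
  proof (rule banach_fix_type[OF norm_ge_zero assms], intro allI)
    show "dist (y - y * x + e) (z - z * x + e) \<le> norm (e - x) * dist y z" for y z
      using norm_mult_ineq[of "y - z" "e - x"] by (simp add: dist_norm algebra_simps)
  qed
  then obtain z where z: "z * x = e"
    by (metis add.commute add_diff_cancel_left' diff_add_cancel diff_add_eq)
  have "z = y"
    using y z by (metis e_mult mult.assoc mult_e)
  with y z show ?thesis by (simp add: cstar_invertibleI)
qed

text \<open>If \<open>y\<close> inverts \<open>e - a * b\<close>, then \<open>e + b * y * a\<close>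
  inverts \<open>e - b * a\<close>.\<close>

lemma cstar_invertible_e_minus_commute:
  assumes "cstar_invertible (e - a * b)"
  shows "cstar_invertible (e - b * a)"
proof -
  obtain y where y: "(e - a * b) * y = e" "y * (e - a * b) = e"
    using assms by (auto simp: cstar_invertible_iff)
  have "(e - b * a) * (e + b * y * a) = e - b * a + b * ((e - a * b) * y) * a"
    by (simp add: algebra_simps)
  moreover have "(e + b * y * a) * (e - b * a) = e - b * a + b * (y * (e - a * b)) * a"
    by (simp add: algebra_simps)
  ultimately show ?thesis
    unfolding y by (intro cstar_invertibleI[where y = "e + b * y * a"]) simp_all
qed

section \<open>Square roots and norm bounds\<close>

lemma inverse_commute:
  assumes "x * y = e" "y * x = e" "q * x = x * q"
  shows "q * y = y * q"
  using assms by (metis e_mult mult.assoc mult_e)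

lemma star_inverse:
  assumes "x * y = e" "y * x = e" "star x = x"
  shows "star y = y"
  using assms by (metis e_mult mult.assoc mult_e star_e star_mult)

text \<open>With \<open>w = e - x\<close> the equation becomes \<open>2 x = a + x * x\<close>, a
  fixed point problem. Self-adjointness and commutation with the commutant of \<open>a\<close> are
  closed conditions preserved by the iteration, so they are built into the domain
  \<open>S\<close>.\<close>

lemma square_root_e_minus:
  assumes "star a = a" "norm a < 1"
  obtains w where "star w = w" "w * w = e - a" "\<And>q. q * a = a * q \<Longrightarrow> q * w = w * q"
proof -
  \<comment> \<open>The smaller root of \<open>r * r - 2 * r + norm a\<close>: the ball of this
    radius is mapped into itself, and the radius is also the contraction constant.\<close>
  define \<rho> where "\<rho> = 1 - sqrt (1 - norm a)"
  have \<rho>: "0 \<le> \<rho>" "\<rho> < 1" "norm a + \<rho> * \<rho> = 2 * \<rho>"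
    using assms(2) by (auto simp: \<rho>_def algebra_simps)
  define S where "S = cball 0 \<rho> \<inter> {x. star x = x} \<inter> (\<Inter>q \<in> {q. q * a = a * q}. {x. q * x = x * q})"
  have S_iff: "x \<in> S \<longleftrightarrow> norm x \<le> \<rho> \<and> star x = x \<and> (\<forall>q. q * a = a * q \<longrightarrow> q * x = x * q)" for x
    unfolding S_def by (simp only: Int_iff INT_iff mem_Collect_eq mem_cball_0) blast
  have "closed S"
    unfolding S_def
    by (intro closed_Int closed_INT ballI closed_Collect_eq continuous_intros closed_cball)
  then have "complete S" by (simp add: complete_eq_closed)
  have "\<exists>!x. x \<in> S \<and> (1/2) *\<^sub>R (a + x * x) = x"
  proof (rule Banach_fix[OF \<open>complete S\<close> _ \<rho>(1,2)])
    have "0 \<in> S" using \<rho>(1) by (simp add: S_iff star_zero)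
    then show "S \<noteq> {}" by blast
    show "(\<lambda>x. (1/2) *\<^sub>R (a + x * x)) ` S \<subseteq> S"
    proof (rule image_subsetI)
      fix x assume x: "x \<in> S"
      then have nx: "norm x \<le> \<rho>" and sx: "star x = x" and qx: "\<And>q. q * a = a * q \<Longrightarrow> q * x = x * q"
        unfolding S_iff by blast+
      have "norm (a + x * x) \<le> norm a + norm x * norm x"
        using norm_triangle_ineq[of a "x * x"] norm_mult_ineq[of x x] by linarith
      also have "\<dots> \<le> 2 * \<rho>"
        using mult_mono[OF nx nx] \<rho> by simp
      finally have "norm ((1/2) *\<^sub>R (a + x * x)) \<le> \<rho>" by simp
      moreover have "star ((1/2) *\<^sub>R (a + x * x)) = (1/2) *\<^sub>R (a + x * x)"
        using sx assms(1) by (simp add: star_scaleR star_add star_mult)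
      moreover have "q * (1/2) *\<^sub>R (a + x * x) = (1/2) *\<^sub>R (a + x * x) * q" if "q * a = a * q" for q
      proof -
        have "q * (x * x) = x * x * q" using qx[OF that] by (metis mult.assoc)
        then show ?thesis using that by (simp add: distrib_left distrib_right)
      qed
      ultimately show "(1/2) *\<^sub>R (a + x * x) \<in> S" unfolding S_iff by blast
    qed
    show "dist ((1/2) *\<^sub>R (a + x * x)) ((1/2) *\<^sub>R (a + y * y)) \<le> \<rho> * dist x y"
      if "x \<in> S" "y \<in> S" for x y
    proof -
      have nx: "norm x \<le> \<rho>" "norm y \<le> \<rho>" using that unfolding S_iff by blast+
      have "(1/2) *\<^sub>R (a + x * x) - (1/2) *\<^sub>R (a + y * y) = (1/2) *\<^sub>R (x * (x - y) + (x - y) * y)"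
        by (simp add: algebra_simps)
      then have "dist ((1/2) *\<^sub>R (a + x * x)) ((1/2) *\<^sub>R (a + y * y))
          = norm (x * (x - y) + (x - y) * y) / 2"
        by (simp add: dist_norm)
      also have "\<dots> \<le> (norm x * norm (x - y) + norm (x - y) * norm y) / 2"
        using norm_triangle_ineq[of "x * (x - y)" "(x - y) * y"] norm_mult_ineq[of x "x - y"]
          norm_mult_ineq[of "x - y" y] by simp
      also have "\<dots> \<le> \<rho> * dist x y"
        using mult_right_mono[OF nx(1), of "norm (x - y)"] mult_right_mono[OF nx(2), of "norm (x - y)"]
        by (simp add: dist_norm mult.commute)
      finally show ?thesis .
    qed
  qed
  then obtain x where x: "x \<in> S" "(1/2) *\<^sub>R (a + x * x) = x" by blast
  have "2 *\<^sub>R x = a + x * x" using arg_cong[OF x(2), of "\<lambda>z. 2 *\<^sub>R z"] by simp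
  then have "(e - x) * (e - x) = e - a"
    by (simp add: algebra_simps scaleR_2)
  moreover have "star (e - x) = e - x" using x(1) unfolding S_iff by (simp only: star_diff star_e)
  moreover have "q * (e - x) = (e - x) * q" if "q * a = a * q" for q
  proof -
    have "q * x = x * q" using x(1) that unfolding S_iff by blast
    then show ?thesis by (simp add: left_diff_distrib right_diff_distrib)
  qed
  ultimately show ?thesis by (intro that[of "e - x"])
qed

text \<open>The element \<open>y + i d\<close> is unitary and \<open>y\<close> is its real part.\<close>

lemma norm_le_one_if_squares_sum_to_e:
  assumes "star y = y" "star d = d" "y * d = d * y" "y * y + d * d = e"
  shows "norm y \<le> 1"
proof -
  define v where "v = y + \<i> *\<^sub>C d"
  have sv: "star v = y - \<i> *\<^sub>C d"
    using assms by (simp add: v_def star_add star_scaleC scaleC_minus_left)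
  have "star v * v = y * y + d * d"
    unfolding sv unfolding v_def using assms(3)
    by (simp add: distrib_left left_diff_distrib mult_scaleC_left mult_scaleC_right scaleC_scaleC
        scaleC_minus_left linear_diff[OF bounded_linear.linear[OF bounded_linear_scaleC]])
  then have "(norm v)\<^sup>2 \<le> 1"
    using cstar_identity[of v] assms(4) norm_e by simp
  then have v: "norm v \<le> 1"
    by (simp add: abs_square_le_1)
  have "2 *\<^sub>R y = v + star v"
    unfolding sv unfolding v_def by (simp add: scaleR_2)
  then have "2 * norm y \<le> norm v + norm (star v)"
    using norm_triangle_ineq[of v "star v"] by (metis abs_numeral norm_scaleR)
  with v show ?thesis by simp
qed

text \<open>For self-adjoint \<open>p\<close> this says that the spectrum of \<open>p\<close> is contained in \<open>[0, 2 M]\<close>.\<close>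

definition nonneg :: "'a \<Rightarrow> bool" where
  "nonneg p \<longleftrightarrow> (\<exists>M\<ge>0. norm (M *\<^sub>R e - p) \<le> M)"

section \<open>Calculus of nonnegative elements\<close>

lemma nonneg_zero: "nonneg 0"
  by (auto simp: nonneg_def intro!: exI[of _ 0])

text \<open>The bounds \<open>M\<close> and \<open>N\<close> add up by the triangle inequality, so
  sums of positive elements need no spectral theory.\<close>

lemma nonneg_add:
  assumes "nonneg p" "nonneg q"
  shows "nonneg (p + q)"
proof -
  obtain M N where M: "M \<ge> 0" "norm (M *\<^sub>R e - p) \<le> M" and N: "N \<ge> 0" "norm (N *\<^sub>R e - q) \<le> N"
    using assms by (auto simp: nonneg_def)
  have "norm ((M + N) *\<^sub>R e - (p + q)) = norm ((M *\<^sub>R e - p) + (N *\<^sub>R e - q))"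
    by (simp add: algebra_simps)
  then have "norm ((M + N) *\<^sub>R e - (p + q)) \<le> M + N"
    using norm_triangle_ineq[of "M *\<^sub>R e - p" "N *\<^sub>R e - q"] M(2) N(2) by linarith
  with M N show ?thesis unfolding nonneg_def by (intro exI[of _ "M + N"]) simp
qed

lemma nonneg_scaleR:
  assumes "nonneg p" "0 \<le> r"
  shows "nonneg (r *\<^sub>R p)"
proof -
  obtain M where M: "M \<ge> 0" "norm (M *\<^sub>R e - p) \<le> M"
    using assms by (auto simp: nonneg_def)
  have "(r * M) *\<^sub>R e - r *\<^sub>R p = r *\<^sub>R (M *\<^sub>R e - p)"
    by (simp add: algebra_simps)
  then have "norm ((r * M) *\<^sub>R e - r *\<^sub>R p) \<le> r * M"
    using M assms(2) by (simp add: mult_left_mono)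
  with M assms(2) show ?thesis unfolding nonneg_def by (intro exI[of _ "r * M"]) simp
qed

lemma nonneg_sum: "(\<And>j. j \<in> J \<Longrightarrow> nonneg (f j)) \<Longrightarrow> nonneg (sum f J)"
  by (induction J rule: infinite_finite_induct) (auto simp: nonneg_zero nonneg_add)

text \<open>Scale \<open>b\<close> to \<open>q\<close> with norm below 1 and let \<open>w\<close> be
  a square root of \<open>e - q * q\<close>. Since \<open>w * w + q * q = e\<close>,
  \<open>w\<close> has norm at most 1, and so has \<open>e - q * q\<close>.\<close>

lemma nonneg_square:
  assumes "star b = b"
  shows "nonneg (b * b)"
proof -
  define m where "m = norm b + 1"
  define q where "q = (1 / m) *\<^sub>R b"
  have m: "m > 0" by (simp add: m_def add_nonneg_pos)
  have sq: "star q = q" using assms by (simp add: q_def star_scaleR)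
  have "norm q < 1" using m by (simp add: q_def m_def)
  then have "norm (q * q) < 1"
    using norm_square_self_adjoint[OF sq] by (simp add: power_less_one_iff)
  then obtain w where w: "star w = w" "w * w = e - q * q" "\<And>x. x * (q * q) = q * q * x \<Longrightarrow> x * w = w * x"
    using square_root_e_minus[of "q * q"] sq by (metis star_mult)
  have "w * q = q * w" using w(3)[of q] by (simp add: mult.assoc)
  then have "norm w \<le> 1"
    using w(1,2) sq by (intro norm_le_one_if_squares_sum_to_e[of w q]) simp_all
  then have "norm (e - q * q) \<le> 1"
    using norm_square_self_adjoint[OF w(1)] w(2) by (simp add: power_le_one)
  moreover have "(m * m) *\<^sub>R e - b * b = (m * m) *\<^sub>R (e - q * q)"
    using m by (simp add: q_def algebra_simps)
  ultimately have "norm ((m * m) *\<^sub>R e - b * b) \<le> m * m"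
    using m by (simp add: mult_left_le)
  with m show ?thesis unfolding nonneg_def by (intro exI[of _ "m * m"]) simp
qed

text \<open>Divided by \<open>M + t\<close>, the element has distance at most
  \<open>M / (M + t) < 1\<close> from \<open>e\<close>.\<close>

lemma cstar_invertible_nonneg_plus:
  assumes "nonneg p" "0 < t"
  shows "cstar_invertible (p + t *\<^sub>R e)"
proof -
  obtain M where M: "M \<ge> 0" "norm (M *\<^sub>R e - p) \<le> M"
    using assms by (auto simp: nonneg_def)
  define x where "x = (1 / (M + t)) *\<^sub>R (p + t *\<^sub>R e)"
  have pos: "0 < M + t" using M assms by simp
  have "e = (1 / (M + t)) *\<^sub>R ((M + t) *\<^sub>R e)" using pos by simp
  then have "e - x = (1 / (M + t)) *\<^sub>R ((M + t) *\<^sub>R e - (p + t *\<^sub>R e))"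
    unfolding x_def scaleR_diff_right by argo
  then have "e - x = (1 / (M + t)) *\<^sub>R (M *\<^sub>R e - p)"
    by (simp add: algebra_simps)
  then have "norm (e - x) < 1"
    using pos M assms by simp
  then have "cstar_invertible ((M + t) *\<^sub>R x)"
    using pos by (intro cstar_invertible_scaleR cstar_invertible_near_e) auto
  then show ?thesis using pos by (simp add: x_def)
qed

text \<open>
  A substitute for the equality of norm and spectral radius: if \<open>e - q\<^sup>2\<close> is invertible, it
  dominates a multiple \<open>\<delta> e\<close>. To have square roots at hand, \<open>q\<close> is replaced by \<open>c q\<close> with \<open>c < 1\<close>.
\<close>

lemma norm_less_one_if_invertible:
  assumes q: "star q = q" "norm q \<le> 1" and inv: "cstar_invertible (e - q * q)"
  shows "norm q < 1"
proof (rule ccontr)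
  assume "\<not> norm q < 1"
  with q have nq: "norm q = 1" by simp
  obtain y where y: "(e - q * q) * y = e" "y * (e - q * q) = e"
    using inv by (auto simp: cstar_invertible_iff)
  define K where "K = norm y + 1"
  define \<delta> where "\<delta> = 1 / (4 * K)"
  \<comment> \<open>The value lies strictly between \<open>sqrt (1 - \<delta>)\<close> and 1: then
    \<open>p\<close> has norm below 1, and the final estimate
    \<open>c \<le> sqrt (1 - \<delta>)\<close> is absurd.\<close>
  define c where "c = sqrt (1 - \<delta> / 2)"
  define p where "p = c *\<^sub>R q"
  define x where "x = e - p * p"
  have K: "1 \<le> K" by (simp add: K_def)
  then have \<delta>: "0 < \<delta>" "\<delta> < 1" "K * \<delta> = 1 / 4" by (auto simp: \<delta>_def field_simps)
  then have c: "0 \<le> c" "c * c = 1 - \<delta> / 2" by (auto simp: c_def)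
  have sp: "star p = p" using q by (simp add: p_def star_scaleR)
  have pp: "p * p = (1 - \<delta> / 2) *\<^sub>R (q * q)" by (simp add: p_def flip: c(2))
  have npp: "norm (p * p) < 1"
    using norm_square_self_adjoint[OF q(1)] nq \<delta> by (simp add: pp)
  have sx: "star x = x" using sp by (simp add: x_def star_diff star_mult)
  have diff: "(e - q * q) - x = - ((\<delta> / 2) *\<^sub>R (q * q))"
    by (simp add: x_def pp algebra_simps)
  have ndiff: "norm ((e - q * q) - x) = \<delta> / 2"
    unfolding diff using norm_square_self_adjoint[OF q(1)] nq \<delta> by simp
  \<comment> \<open>\<open>x\<close> is so close to \<open>e - q * q\<close> that
    \<open>y * x\<close> is near \<open>e\<close>; hence \<open>x\<close> is invertible too.\<close>
  have "e - y * x = y * ((e - q * q) - x)"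
    using y by (simp add: right_diff_distrib)
  then have "norm (e - y * x) \<le> norm y * (\<delta> / 2)"
    using norm_mult_ineq[of y "(e - q * q) - x"] ndiff by simp
  also have "\<dots> \<le> K * (\<delta> / 2)" using \<delta> by (intro mult_right_mono) (auto simp: K_def)
  also have "\<dots> < 1" using \<delta> by simp
  finally have "cstar_invertible (y * x)" by (rule cstar_invertible_near_e)
  then have "cstar_invertible ((e - q * q) * (y * x))"
    using inv by (rule cstar_invertible_mult[rotated])
  moreover have "(e - q * q) * (y * x) = x" using y by (metis e_mult mult.assoc)
  ultimately obtain z where z: "x * z = e" "z * x = e"
    by (auto simp: cstar_invertible_iff)
  \<comment> \<open>The resolvent identity bounds \<open>norm z\<close> in terms of
    \<open>norm y\<close>, so that \<open>e - \<delta> *\<^sub>R z\<close> has a square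
    root.\<close>
  have "z - y = z * (((e - q * q) - x) * y)"
    using y z by (simp add: left_diff_distrib right_diff_distrib flip: mult.assoc)
  then have "norm (z - y) \<le> norm z * (\<delta> / 2 * norm y)"
    using norm_mult_ineq[of z "((e - q * q) - x) * y"] norm_mult_ineq[of "(e - q * q) - x" y] ndiff
    by (smt (verit) mult_left_mono norm_ge_zero)
  also have "\<dots> \<le> norm z * (\<delta> / 2 * K)"
    using \<delta> by (intro mult_left_mono) (auto simp: K_def)
  also have "\<dots> = norm z / 8" using \<delta>(3) by (simp add: mult.commute)
  finally have "norm (z - y) \<le> norm z / 8" .
  moreover have "norm z \<le> norm y + norm (z - y)" by (rule norm_triangle_sub)
  moreover have "0 \<le> norm y" by simp
  ultimately have "norm z \<le> 2 * (norm y + 1)" by argo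
  then have "norm z \<le> 2 * K" unfolding K_def .
  then have "\<delta> * norm z \<le> 2 * (K * \<delta>)" using mult_left_mono[of "norm z" "2 * K" \<delta>] \<delta>(1) by (simp add: mult_ac)
  also have "\<dots> < 1" using \<delta>(3) by (simp add: mult.commute)
  finally have nz: "norm (\<delta> *\<^sub>R z) < 1" using \<delta>(1) by simp
  have sz: "star z = z" using star_inverse[OF z sx] .
  have qx: "p * x = x * p" by (simp add: x_def algebra_simps)
  have qz: "p * z = z * p" using inverse_commute[OF z qx] .
  obtain w where w: "star w = w" "w * w = x" "\<And>u. u * (p * p) = p * p * u \<Longrightarrow> u * w = w * u"
    using square_root_e_minus[of "p * p"] npp sp by (metis star_mult x_def)
  obtain g where g: "star g = g" "g * g = e - \<delta> *\<^sub>R z" "\<And>u. u * (\<delta> *\<^sub>R z) = \<delta> *\<^sub>R z * u \<Longrightarrow> u * g = g * u"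
    using square_root_e_minus[of "\<delta> *\<^sub>R z"] nz sz by (metis star_scaleR)
  have pw: "p * w = w * p" by (rule w(3)) (simp add: mult.assoc)
  have pg: "p * g = g * p" by (rule g(3)) (simp add: qz)
  have "w * x = x * w" using w(2) by (metis mult.assoc)
  then have "w * z = z * w" by (rule inverse_commute[OF z])
  then have wg: "w * g = g * w" by (intro g(3)) simp
  \<comment> \<open>As \<open>w\<close> and \<open>g\<close> commute, \<open>d * d = x * (e -
    \<delta> *\<^sub>R z) = x - \<delta> *\<^sub>R e\<close>: the gap below \<open>x\<close> is a
    square.\<close>
  define d where "d = w * g"
  have sd: "star d = d" using w(1) g(1) wg by (simp add: d_def star_mult)
  have pd: "p * d = d * p" unfolding d_def using pw pg by (metis mult.assoc)
  have "d * d = w * w * (g * g)" unfolding d_def using wg by (metis mult.assoc)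
  also have "\<dots> = x - \<delta> *\<^sub>R e" using z by (simp add: w g right_diff_distrib)
  finally have dd: "p * p + d * d = (1 - \<delta>) *\<^sub>R e" by (simp add: x_def algebra_simps)
  define k where "k = 1 / sqrt (1 - \<delta>)"
  have k: "0 < k" "k * k * (1 - \<delta>) = 1" using \<delta> by (auto simp: k_def)
  have "norm (k *\<^sub>R p) \<le> 1"
  proof (rule norm_le_one_if_squares_sum_to_e[of _ "k *\<^sub>R d"])
    have "k *\<^sub>R p * k *\<^sub>R p + k *\<^sub>R d * k *\<^sub>R d = (k * k) *\<^sub>R (p * p + d * d)"
      by (simp add: algebra_simps)
    then show "k *\<^sub>R p * k *\<^sub>R p + k *\<^sub>R d * k *\<^sub>R d = e" using dd k by simp
  qed (use sp sd pd in \<open>simp_all add: star_scaleR\<close>)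
  then have "k * c \<le> 1" using k c nq by (simp add: p_def)
  then have "c \<le> sqrt (1 - \<delta>)" using \<delta> by (simp add: k_def field_simps)
  with \<delta> show False by (simp add: c_def)
qed


section \<open>Sums of squares\<close>

lemma cstar_invertible_sum_squares:
  assumes "finite J" and b: "\<And>j. j \<in> J \<Longrightarrow> star (b j) = b j" and x: "(\<Sum>j\<in>J. x j * b j) = e"
  shows "cstar_invertible (\<Sum>j\<in>J. b j * b j)"
proof -
  define s where "s = (\<Sum>j\<in>J. b j * b j)"
  define X where "X = (\<Sum>j\<in>J. norm (x j))"
  define \<tau> where "\<tau> = 1 / (X + 1)"
  define t where "t = \<tau> * \<tau>"
  have X: "0 \<le> X" by (simp add: X_def sum_nonneg)
  then have \<tau>: "0 < \<tau>" "\<tau> * X < 1" by (auto simp: \<tau>_def)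
  then have t: "0 < t" by (simp add: t_def)
  have ns: "nonneg s" unfolding s_def by (intro nonneg_sum nonneg_square b)
  have ss: "star s = s" by (simp add: s_def star_sum star_mult b cong: sum.cong)
  define h where "h = s + t *\<^sub>R e"
  have ih: "cstar_invertible h" unfolding h_def using ns t by (rule cstar_invertible_nonneg_plus)
  then obtain r where r: "h * r = e" "r * h = e" by (auto simp: cstar_invertible_iff)
  have sr: "star r = r" by (rule star_inverse[OF r]) (simp add: h_def star_add star_scaleR ss)
  have ir: "cstar_invertible r" using r by (intro cstar_invertibleI)
  have inv: "cstar_invertible (e - \<kappa> *\<^sub>R (b i * (r * (r * b i))))" if i: "i \<in> J" and \<kappa>: "\<bar>\<kappa>\<bar> \<le> t" for i \<kappa>
  proof -
    \<comment> \<open>Since \<open>h * h = s * s + 2 t s + t * t e\<close>, subtracting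
      \<open>\<kappa>\<close> times the square of \<open>b i\<close> only lowers one coefficient
      from \<open>2 t\<close> to \<open>2 t - \<kappa>\<close>, which stays positive.\<close>
    define p where "p = s * s + (\<Sum>j\<in>J-{i}. (2 * t) *\<^sub>R (b j * b j)) + (2 * t - \<kappa>) *\<^sub>R (b i * b i)"
    have "nonneg p"
      unfolding p_def using \<kappa> t i
      by (intro nonneg_add nonneg_sum nonneg_scaleR nonneg_square ss b) auto
    then have "cstar_invertible (p + (t * t) *\<^sub>R e)"
      using t by (intro cstar_invertible_nonneg_plus) auto
    moreover have "p + (t * t) *\<^sub>R e = h * h - \<kappa> *\<^sub>R (b i * b i)"
    proof -
      have "s = b i * b i + (\<Sum>j\<in>J-{i}. b j * b j)"
        unfolding s_def using assms(1) i by (rule sum.remove)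
      then have "(\<Sum>j\<in>J-{i}. (2 * t) *\<^sub>R (b j * b j)) = (2 * t) *\<^sub>R (s - b i * b i)"
        by (simp flip: scaleR_sum_right)
      then have "p = s * s + (2 * t) *\<^sub>R s - \<kappa> *\<^sub>R (b i * b i)"
        by (simp add: p_def algebra_simps)
      moreover have "h * h = s * s + (2 * t) *\<^sub>R s + (t * t) *\<^sub>R e"
        by (simp add: h_def algebra_simps flip: scaleR_2)
      ultimately show ?thesis by simp
    qed
    ultimately have "cstar_invertible (r * r * (h * h - \<kappa> *\<^sub>R (b i * b i)))"
      using ir by (simp add: cstar_invertible_mult)
    moreover have "r * r * (h * h) = e" using r by (metis e_mult mult.assoc)
    \<comment> \<open>Multiplying by \<open>r * r\<close>, the inverse of \<open>h * h\<close>,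
      gives this form; swapping the two factors yields the claim.\<close>
    ultimately have "cstar_invertible (e - (r * (r * b i)) * (\<kappa> *\<^sub>R b i))"
      by (simp add: right_diff_distrib mult.assoc)
    then show ?thesis
      using cstar_invertible_e_minus_commute by fastforce
  qed
  have bound: "norm (\<tau> *\<^sub>R (b i * r)) \<le> 1" if i: "i \<in> J" for i
  proof -
    define c where "c = \<tau> *\<^sub>R (b i * r)"
    define z where "z = c * star c"
    have z: "z = t *\<^sub>R (b i * (r * (r * b i)))"
      by (simp add: z_def c_def t_def star_scaleR star_mult sr b i mult.assoc)
    have sz: "star z = z" by (simp add: z_def star_mult star_star)
    have nz: "norm z = (norm c)\<^sup>2"
      using cstar_identity[of "star c"] by (simp add: z_def star_star)
    have "norm z \<le> 1"
    proof (rule ccontr)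
      assume "\<not> norm z \<le> 1"
      then have \<mu>: "1 < norm z" by simp
      define q where "q = (1 / norm z) *\<^sub>R z"
      have sq: "star q = q" by (simp add: q_def star_scaleR sz)
      have nq: "norm q = 1" using \<mu> by (auto simp: q_def)
      have "t \<le> t * norm z" using \<mu> t by simp
      \<comment> \<open>Both signs of \<open>\<kappa>\<close> are used, so that \<open>e - q\<close>
        and \<open>e + q\<close> are invertible, although \<open>q\<close> is self-adjoint of norm
        1.\<close>
      then have "\<bar>t / norm z\<bar> \<le> t" "\<bar>- (t / norm z)\<bar> \<le> t"
        using \<mu> t by (simp_all add: divide_le_eq)
      then have "cstar_invertible (e - (t / norm z) *\<^sub>R (b i * (r * (r * b i))))"
        "cstar_invertible (e - (- (t / norm z)) *\<^sub>R (b i * (r * (r * b i))))"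
        by (blast intro: inv[OF i])+
      moreover have "(t / norm z) *\<^sub>R (b i * (r * (r * b i))) = q"
        using \<mu> by (simp add: q_def) (simp add: z)
      ultimately have "cstar_invertible ((e - q) * (e + q))"
        by (intro cstar_invertible_mult) simp_all
      then have "cstar_invertible (e - q * q)"
        by (simp add: algebra_simps)
      with norm_less_one_if_invertible[OF sq] nq show False by simp
    qed
    then show ?thesis by (simp add: nz c_def[symmetric] abs_square_le_1)
  qed
  have "\<tau> *\<^sub>R r = (\<Sum>j\<in>J. x j * (\<tau> *\<^sub>R (b j * r)))"
  proof -
    have "\<tau> *\<^sub>R r = \<tau> *\<^sub>R ((\<Sum>j\<in>J. x j * b j) * r)" by (simp add: x)
    then show ?thesis by (simp add: sum_distrib_right scaleR_sum_right mult.assoc)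
  qed
  then have "norm (\<tau> *\<^sub>R r) \<le> (\<Sum>j\<in>J. norm (x j * (\<tau> *\<^sub>R (b j * r))))"
    by (simp only: norm_sum)
  also have "\<dots> \<le> X"
    unfolding X_def
  proof (rule sum_mono)
    fix j assume "j \<in> J"
    then have "norm (x j) * norm (\<tau> *\<^sub>R (b j * r)) \<le> norm (x j)"
      using bound by (intro mult_left_le) auto
    then show "norm (x j * (\<tau> *\<^sub>R (b j * r))) \<le> norm (x j)"
      using norm_mult_ineq order_trans by blast
  qed
  finally have "\<tau> * norm (\<tau> *\<^sub>R r) \<le> \<tau> * X" using \<tau> by (intro mult_left_mono) auto
  moreover have "norm (t *\<^sub>R r) = \<tau> * norm (\<tau> *\<^sub>R r)"
    using \<tau>(1) by (simp add: t_def abs_mult)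
  ultimately have "norm (t *\<^sub>R r) < 1" using \<tau>(2) by linarith
  moreover have "s * r + t *\<^sub>R r = e"
    using r(1) by (simp add: h_def distrib_right)
  \<comment> \<open>Hence \<open>s * r\<close> is invertible, and multiplying by \<open>h\<close>
    recovers \<open>s\<close>.\<close>
  then have "e - s * r = t *\<^sub>R r"
    by (metis add_diff_cancel_left')
  ultimately have "cstar_invertible (s * r)"
    by (intro cstar_invertible_near_e) simp
  then have "cstar_invertible (s * r * h)"
    using ih by (rule cstar_invertible_mult)
  then show ?thesis using r by (simp add: mult.assoc s_def)
qed

section \<open>Generated subalgebras and left ideals\<close>

definition left_ideal :: "('i \<Rightarrow> 'a) \<Rightarrow> 'i set \<Rightarrow> 'a set" where
  "left_ideal b J = range (\<lambda>x. \<Sum>j\<in>J. x j * b j)"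

lemma left_ideal_add: "u \<in> left_ideal b J \<Longrightarrow> v \<in> left_ideal b J \<Longrightarrow> u + v \<in> left_ideal b J"
  unfolding left_ideal_def
  by (auto simp flip: sum.distrib distrib_right)

lemma left_ideal_mult: "u \<in> left_ideal b J \<Longrightarrow> a * u \<in> left_ideal b J"
  unfolding left_ideal_def
  by (auto simp: sum_distrib_left simp flip: mult.assoc)

lemma generator_in_left_ideal:
  assumes "finite J" "i \<in> J"
  shows "b i \<in> left_ideal b J"
proof -
  have "(\<Sum>j\<in>J. (if j = i then e else 0) * b j) = (\<Sum>j\<in>J. if j = i then b j else 0)"
    by (intro sum.cong) auto
  with assms have "b i = (\<Sum>j\<in>J. (if j = i then e else 0) * b j)" by simp
  then show ?thesis unfolding left_ideal_def by (rule range_eqI[of _ _ "\<lambda>j. if j = i then e else 0"])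
qed

lemma closure_left_ideal_mult:
  assumes "u \<in> closure (left_ideal b J)"
  shows "a * u \<in> closure (left_ideal b J)"
proof -
  have "((*) a) ` closure (left_ideal b J) \<subseteq> closure (left_ideal b J)"
    by (rule image_closure_subset)
      (auto intro!: continuous_on_mult_left continuous_on_id subsetD[OF closure_subset] left_ideal_mult)
  with assms show ?thesis by blast
qed

lemma closure_left_ideal_add:
  assumes "u \<in> closure (left_ideal b J)" "v \<in> closure (left_ideal b J)"
  shows "u + v \<in> closure (left_ideal b J)"
proof -
  obtain f g where "\<And>n. f n \<in> left_ideal b J" "f \<longlonglongrightarrow> u" "\<And>n. g n \<in> left_ideal b J" "g \<longlonglongrightarrow> v"
    using assms by (auto simp: closure_sequential)
  then show ?thesis
    by (auto simp: closure_sequential intro!: exI[of _ "\<lambda>n. f n + g n"] left_ideal_add tendsto_add)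
qed

text \<open>A closed left ideal need not be closed under \<open>star\<close>, but its intersection
  \<open>S\<close> with its adjoint is a C*-subalgebra, and it contains the self-adjoint
  generators.\<close>

lemma cstar_generated_subset_closure_left_ideal:
  assumes "finite J" and b: "\<And>j. j \<in> J \<Longrightarrow> star (b j) = b j"
  shows "cstar_generated (b ` J) \<subseteq> closure (left_ideal b J)"
proof -
  let ?L = "closure (left_ideal b J)"
  define S where "S = {g. g \<in> ?L \<and> star g \<in> ?L}"
  have "closed S"
  proof -
    have "S = ?L \<inter> star -` ?L" by (auto simp: S_def)
    then show ?thesis
      by (simp add: closed_Int closed_vimage continuous_on_star[OF continuous_on_id])
  qed
  moreover have "0 \<in> S"
  proof -
    have "(0::'a) \<in> left_ideal b J" unfolding left_ideal_def by (rule range_eqI[of _ _ "\<lambda>_. 0"]) simp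
    then show ?thesis using closure_subset by (auto simp: S_def star_zero)
  qed
  moreover have "c *\<^sub>C x \<in> S" if "x \<in> S" for c x
  proof -
    \<comment> \<open>Scalars act as left multiplication by multiples of the unit.\<close>
    have "c *\<^sub>C x = c *\<^sub>C e * x" "star (c *\<^sub>C x) = cnj c *\<^sub>C e * star x"
      by (simp_all add: mult_scaleC_left star_scaleC)
    with that show ?thesis
      by (simp only: S_def mem_Collect_eq closure_left_ideal_mult)
  qed
  ultimately have "cstar_subalgebra S"
    unfolding cstar_subalgebra_def
    by (auto simp: S_def star_add star_mult star_star closure_left_ideal_add closure_left_ideal_mult)
  moreover have "b ` J \<subseteq> S"
    using closure_subset generator_in_left_ideal[OF assms(1)] b by (fastforce simp: S_def)
  ultimately have "cstar_generated (b ` J) \<subseteq> S"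
    unfolding cstar_generated_def by (rule hull_minimal[rotated])
  then show ?thesis by (auto simp: S_def)
qed

lemma cstar_invertible_sum_squares_if_near_generated:
  assumes "finite J" and b: "\<And>j. j \<in> J \<Longrightarrow> star (b j) = b j"
    and g: "g \<in> cstar_generated (b ` J)" "norm (e - g) < 1"
  shows "cstar_invertible (\<Sum>j\<in>J. b j * b j)"
proof -
  have "g \<in> closure (left_ideal b J)"
    using cstar_generated_subset_closure_left_ideal[of J b] assms by blast
  \<comment> \<open>This slack allows \<open>g\<close> to be replaced by an element of the unclosed
    ideal, where \<open>e\<close> becomes a finite combination of the \<open>b j\<close>.\<close>
  moreover have "0 < 1 - norm (e - g)" using g(2) by simp
  ultimately obtain l where l: "l \<in> left_ideal b J" "dist l g < 1 - norm (e - g)"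
    unfolding closure_approachable by blast
  have "norm (e - l) < 1"
    using l(2) dist_triangle[of e l g] by (simp add: dist_norm norm_minus_commute)
  then obtain y where "y * l = e"
    using cstar_invertible_near_e cstar_invertible_iff by blast
  then have "e \<in> left_ideal b J" using left_ideal_mult[OF l(1), of y] by simp
  then obtain x where "(\<Sum>j\<in>J. x j * b j) = e" by (auto simp: left_ideal_def)
  with assms(1) b show ?thesis by (rule cstar_invertible_sum_squares)
qed

end


section \<open>Ranks\<close>

text \<open>Only finitely many coordinates occur, so the least of the coordinate radii serves all of
  them. This turns density into an estimate in norm.\<close>

lemma sa_tuples_open_ball:
  assumes "openin (sa_tuples n) U" "a \<in> U"
  obtains \<epsilon> where "0 < \<epsilon>"
    "\<And>b. b \<in> {..n} \<rightarrow>\<^sub>E self_adjoint \<Longrightarrow> (\<And>j. j \<le> n \<Longrightarrow> norm (b j - a j) < \<epsilon>) \<Longrightarrow> b \<in> U"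
proof -
  obtain V where V: "\<And>j. j \<in> {..n} \<Longrightarrow> openin (top_of_set self_adjoint) (V j)"
    "a \<in> Pi\<^sub>E {..n} V" "Pi\<^sub>E {..n} V \<subseteq> U"
    using assms(1)[unfolded sa_tuples_def openin_product_topology_alt, rule_format, OF assms(2)]
    by metis
  have "\<exists>d>0. \<forall>y\<in>self_adjoint. dist y (a j) < d \<longrightarrow> y \<in> V j" if "j \<le> n" for j
    using V(1)[of j] V(2) that unfolding openin_euclidean_subtopology_iff by auto
  then obtain d where d: "\<And>j. j \<le> n \<Longrightarrow> 0 < d j"
    "\<And>j y. j \<le> n \<Longrightarrow> y \<in> self_adjoint \<Longrightarrow> dist y (a j) < d j \<Longrightarrow> y \<in> V j"
    by metis
  show ?thesis
  proof
    show "0 < Min (d ` {..n})" using d(1) by simp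
    show "b \<in> U" if "b \<in> {..n} \<rightarrow>\<^sub>E self_adjoint" "\<And>j. j \<le> n \<Longrightarrow> norm (b j - a j) < Min (d ` {..n})" for b
    proof -
      have "b j \<in> V j" if "j \<le> n" for j
        using \<open>b \<in> {..n} \<rightarrow>\<^sub>E self_adjoint\<close> \<open>\<And>j. j \<le> n \<Longrightarrow> norm (b j - a j) < Min (d ` {..n})\<close>[OF that]
          that by (intro d(2)) (auto simp: dist_norm)
      with that(1) have "b \<in> Pi\<^sub>E {..n} V" by (simp add: PiE_iff)
      with V(3) show ?thesis by (rule subsetD)
    qed
  qed
qed

lemma unital_rr_le_gr0:
  assumes "is_identity (e :: 'a::cstar_algebra)"
  shows "unital_rr TYPE('a) \<le> gr0 TYPE('a)"
proof -
  interpret unital_cstar_algebra e by standard (rule assms)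
  show ?thesis
    unfolding unital_rr_def gr0_def
  \<comment> \<open>It suffices that every \<open>n\<close> admissible for \<open>gr0\<close> is
    admissible for \<open>unital_rr\<close>.\<close>
  proof (rule Inf_superset_mono, rule image_mono, rule subsetI, unfold mem_Collect_eq)
    fix n :: nat
    assume gr: "\<forall>a \<in> {..n} \<rightarrow> self_adjoint. \<forall>\<epsilon>>0. \<forall>c::'a. \<exists>b \<in> {..n} \<rightarrow> self_adjoint.
      (\<forall>j\<le>n. norm (b j - a j) < \<epsilon>) \<and> (\<exists>g \<in> cstar_generated (b ` {..n}). norm (c - g) < \<epsilon>)"
    let ?I = "{a \<in> topspace (sa_tuples n). cstar_invertible (\<Sum>j\<le>n. star (a j) * (a j :: 'a))}"
    have top: "topspace (sa_tuples n) = {..n} \<rightarrow>\<^sub>E (self_adjoint :: 'a set)"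
      by (simp add: sa_tuples_def)
    have "a \<in> sa_tuples n closure_of ?I" if a: "a \<in> topspace (sa_tuples n)" for a
      unfolding in_closure_of
    proof (intro conjI a allI impI)
      fix U assume U: "a \<in> U \<and> openin (sa_tuples n) U"
      then obtain \<epsilon> where \<epsilon>: "0 < \<epsilon>"
        "\<And>b. b \<in> {..n} \<rightarrow>\<^sub>E self_adjoint \<Longrightarrow> (\<And>j. j \<le> n \<Longrightarrow> norm (b j - a j) < \<epsilon>) \<Longrightarrow> b \<in> U"
        using sa_tuples_open_ball by blast
      have "a \<in> {..n} \<rightarrow> self_adjoint" using a by (auto simp: top)
      \<comment> \<open>\<open>\<epsilon>\<close> keeps the new tuple in \<open>U\<close>; the bound
        1 is for the distance of \<open>e\<close> from the generated algebra.\<close>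
      moreover have "0 < min \<epsilon> 1" using \<epsilon>(1) by simp
      ultimately have "\<exists>b \<in> {..n} \<rightarrow> self_adjoint. (\<forall>j\<le>n. norm (b j - a j) < min \<epsilon> 1) \<and>
          (\<exists>g \<in> cstar_generated (b ` {..n}). norm (e - g) < min \<epsilon> 1)"
        using gr[rule_format] by presburger
      then obtain b g where b: "b \<in> {..n} \<rightarrow> self_adjoint" "\<And>j. j \<le> n \<Longrightarrow> norm (b j - a j) < min \<epsilon> 1"
        and g: "g \<in> cstar_generated (b ` {..n})" "norm (e - g) < min \<epsilon> 1"
        by blast
      have sb: "star (b j) = b j" if "j \<in> {..n}" for j
        using b(1) that by (auto simp: self_adjoint_def)
      have inv: "cstar_invertible (\<Sum>j\<le>n. b j * b j)"
        using cstar_invertible_sum_squares_if_near_generated[OF finite_atMost sb g(1)] g(2) by simp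
      \<comment> \<open>Points of the product space are extensional, so \<open>b\<close> must be
        restricted to \<open>{..n}\<close>.\<close>
      have sum: "(\<Sum>j\<le>n. star (restrict b {..n} j) * restrict b {..n} j) = (\<Sum>j\<le>n. b j * b j)"
        by (intro sum.cong) (simp_all add: sb)
      have rb: "restrict b {..n} \<in> {..n} \<rightarrow>\<^sub>E self_adjoint"
        using b(1) by (simp add: restrict_PiE_iff Pi_iff)
      moreover have "restrict b {..n} \<in> U"
        using rb by (rule \<epsilon>(2)) (use b(2) in auto)
      ultimately show "\<exists>y. y \<in> ?I \<and> y \<in> U"
        unfolding top by (intro exI[of _ "restrict b {..n}"]) (simp only: mem_Collect_eq sum inv simp_thms)
    qed
    then show "sa_tuples n closure_of ?I = topspace (sa_tuples n)"
      by (intro subset_antisym closure_of_subset_topspace subsetI)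
  qed
qed

theorem proposition3p10:
  shows "rr TYPE('a::cstar_algebra) \<le> gr TYPE('a)"
proof (cases "unital TYPE('a)")
  case True
  then obtain e :: 'a where "is_identity e" by (auto simp: unital_def)
  with True show ?thesis by (simp add: rr_def gr_def unital_rr_le_gr0)
next
  case False
  then show ?thesis
    by (simp add: rr_def gr_def unital_rr_le_gr0[OF is_identity_unitization])
qed

end
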